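(* Let $\kappa$ be a cardinal and assume $\mathbf{MA}_\kappa(\sigma\text{-centered})$. If $\mathbb{P}$ is a $\sigma$-linked atomless forcing notion of size $\kappa$, then $\mathbb{P}$ adds a Cohen real.
   Context: A stronger forcing condition is the greater one. For a forcing notion $\mathbb{P}$ and a cardinal $\kappa$, $\mathbf{MA}_\kappa(\mathbb{P})$ is the statement: if $\mathcal{A}_\alpha\subseteq\mathbb{P}$ ($\alpha<\kappa$) are maximal antichains of $\mathbb{P}$ and $p\in\mathbb{P}$, then there exists a filter $G\subseteq\mathbb{P}$ with $p\in G$ and $G\cap\mathcal{A}_\alpha\neq\emptyset$ for all $\alpha<\kappa$. For a class $\mathcal{K}$ of forcing notions, $\mathbf{MA}_\kappa(\mathcal{K})$ means $\mathbf{MA}_\kappa(\mathbb{P})$ holds for every $\mathbb{P}\in\mathcal{K}$. $\sigma$-centered: $\mathbb{P}$ is a countable union of sets each of whose finite subsets has a common upper bound; $\sigma$-linked: $\mathbb{P}$ is a countable union of sets any two elements of which are compatible. *)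

theory Defs
  imports Main "HOL-Library.Sublist"
begin

section \<open>Forcing notions and Martin's axiom\<close>

text \<open>
  A forcing notion is a nonempty preordered set \<open>P\<close>, given by its carrier and its order relation \<open>r\<close>.
  The greater condition is the stronger one: \<open>(p, q) \<in> r\<close> means that \<open>q\<close> is stronger than \<open>p\<close>.
\<close>

definition forcing_notion :: "'a set \<Rightarrow> 'a rel \<Rightarrow> bool" where
  "forcing_notion P r \<longleftrightarrow> P \<noteq> {} \<and> preorder_on P r"

definition compatible :: "'a set \<Rightarrow> 'a rel \<Rightarrow> 'a \<Rightarrow> 'a \<Rightarrow> bool" where
  "compatible P r p q \<longleftrightarrow> (\<exists>u\<in>P. (p, u) \<in> r \<and> (q, u) \<in> r)"

definition maximal_antichain :: "'a set \<Rightarrow> 'a rel \<Rightarrow> 'a set \<Rightarrow> bool" where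
  "maximal_antichain P r A \<longleftrightarrow> A \<subseteq> P \<and>
     (\<forall>a\<in>A. \<forall>b\<in>A. a \<noteq> b \<longrightarrow> \<not> compatible P r a b) \<and>
     (\<forall>p\<in>P. \<exists>a\<in>A. compatible P r p a)"

definition forcing_filter :: "'a set \<Rightarrow> 'a rel \<Rightarrow> 'a set \<Rightarrow> bool" where
  "forcing_filter P r G \<longleftrightarrow> G \<noteq> {} \<and> G \<subseteq> P \<and>
     (\<forall>q\<in>G. \<forall>p\<in>P. (p, q) \<in> r \<longrightarrow> p \<in> G) \<and>
     (\<forall>p\<in>G. \<forall>q\<in>G. \<exists>u\<in>G. (p, u) \<in> r \<and> (q, u) \<in> r)"

definition atomless :: "'a set \<Rightarrow> 'a rel \<Rightarrow> bool" where
  "atomless P r \<longleftrightarrow>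
     (\<forall>p\<in>P. \<exists>q\<in>P. \<exists>q'\<in>P. (p, q) \<in> r \<and> (p, q') \<in> r \<and> \<not> compatible P r q q')"

definition sigma_centered :: "'a set \<Rightarrow> 'a rel \<Rightarrow> bool" where
  "sigma_centered P r \<longleftrightarrow> (\<exists>C :: nat \<Rightarrow> 'a set. P = (\<Union>n. C n) \<and>
     (\<forall>n F. finite F \<and> F \<subseteq> C n \<longrightarrow> (\<exists>u\<in>P. \<forall>p\<in>F. (p, u) \<in> r)))"

definition sigma_linked :: "'a set \<Rightarrow> 'a rel \<Rightarrow> bool" where
  "sigma_linked P r \<longleftrightarrow> (\<exists>L :: nat \<Rightarrow> 'a set. P = (\<Union>n. L n) \<and>
     (\<forall>n. \<forall>p\<in>L n. \<forall>q\<in>L n. compatible P r p q))"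

text \<open>
  Cardinals are represented as in the HOL library, by well-orders \<open>\<kappa>\<close> with \<^term>\<open>Card_order \<kappa>\<close>;
  the ordinals below the cardinal are the elements of \<^term>\<open>Field \<kappa>\<close>.
\<close>

definition MA :: "'k rel \<Rightarrow> 'a set \<Rightarrow> 'a rel \<Rightarrow> bool" where
  "MA \<kappa> P r \<longleftrightarrow> (\<forall>A. \<forall>p\<in>P. (\<forall>\<alpha>\<in>Field \<kappa>. maximal_antichain P r (A \<alpha>)) \<longrightarrow>
     (\<exists>G. forcing_filter P r G \<and> p \<in> G \<and> (\<forall>\<alpha>\<in>Field \<kappa>. G \<inter> A \<alpha> \<noteq> {})))"

text \<open>
  A class of forcing notions consists of forcing notions whose carriers are subsets of an
  ambient type \<open>'a\<close>. For \<open>\<sigma>\<close>-centered forcing notions and infinite \<open>\<kappa>\<close> the axiom does not depend on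
  this type, as long as it has at least \<open>\<kappa>\<close> elements; see \<open>MA_class_sigma_centered_any_type\<close> below.
\<close>

definition MA_class :: "'k rel \<Rightarrow> ('a set \<Rightarrow> 'a rel \<Rightarrow> bool) \<Rightarrow> bool" where
  "MA_class \<kappa> K \<longleftrightarrow> (\<forall>P r. forcing_notion P r \<and> K P r \<longrightarrow> MA \<kappa> P r)"


section \<open>The forcing relation and Cohen reals\<close>

text \<open>
  The ground model is the universe of HOL. A sentence of the forcing language is represented by
  the predicate \<open>\<phi>\<close> for which \<open>\<phi> p\<close> means that \<open>p\<close> forces it; the definitions below are the
  clauses of the usual recursive definition of forcing, with quantifiers ranging over
  ground model sets. A name for a real, that is, for a subset of \<open>\<omega>\<close>, is a set \<open>\<tau>\<close> of pairs \<open>(n, p)\<close>,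
  representing the name that consists of the pairs of the canonical name of \<open>n\<close> and \<open>p\<close>.
\<close>

definition forced_mem :: "'a set \<Rightarrow> 'a rel \<Rightarrow> 'x \<Rightarrow> ('x \<times> 'a) set \<Rightarrow> 'a \<Rightarrow> bool" where
  "forced_mem P r x \<tau> p \<longleftrightarrow>
     (\<forall>q\<in>P. (p, q) \<in> r \<longrightarrow> (\<exists>u\<in>P. (q, u) \<in> r \<and> (\<exists>s. (x, s) \<in> \<tau> \<and> (s, u) \<in> r)))"

definition forced_not :: "'a set \<Rightarrow> 'a rel \<Rightarrow> ('a \<Rightarrow> bool) \<Rightarrow> 'a \<Rightarrow> bool" where
  "forced_not P r \<phi> p \<longleftrightarrow> (\<forall>q\<in>P. (p, q) \<in> r \<longrightarrow> \<not> \<phi> q)"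

definition forced_all :: "'i set \<Rightarrow> ('i \<Rightarrow> 'a \<Rightarrow> bool) \<Rightarrow> 'a \<Rightarrow> bool" where
  "forced_all I \<Phi> p \<longleftrightarrow> (\<forall>i\<in>I. \<Phi> i p)"

definition forced_ex :: "'a set \<Rightarrow> 'a rel \<Rightarrow> 'i set \<Rightarrow> ('i \<Rightarrow> 'a \<Rightarrow> bool) \<Rightarrow> 'a \<Rightarrow> bool" where
  "forced_ex P r I \<Phi> p \<longleftrightarrow> (\<forall>q\<in>P. (p, q) \<in> r \<longrightarrow> (\<exists>u\<in>P. (q, u) \<in> r \<and> (\<exists>i\<in>I. \<Phi> i u)))"

text \<open>
  The finite binary sequence \<open>s\<close> is an initial segment of the characteristic function of the real
  named by \<open>\<tau>\<close>.
\<close>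

definition forced_initial_segment ::
  "'a set \<Rightarrow> 'a rel \<Rightarrow> bool list \<Rightarrow> (nat \<times> 'a) set \<Rightarrow> 'a \<Rightarrow> bool" where
  "forced_initial_segment P r s \<tau> =
     forced_all {..<length s}
       (\<lambda>i. if s ! i then forced_mem P r i \<tau> else forced_not P r (forced_mem P r i \<tau>))"

definition dense_in_Cohen :: "bool list set \<Rightarrow> bool" where
  "dense_in_Cohen D \<longleftrightarrow> (\<forall>s. \<exists>t\<in>D. prefix s t)"

text \<open>
  A real is Cohen over the ground model if for every dense subset \<open>D\<close> of the Cohen forcing
  \<open>2\<^bsup><\<omega>\<^esup>\<close> that belongs to the ground model, some initial segment of the real is in \<open>D\<close>.
\<close>

definition forced_Cohen :: "'a set \<Rightarrow> 'a rel \<Rightarrow> (nat \<times> 'a) set \<Rightarrow> 'a \<Rightarrow> bool" where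
  "forced_Cohen P r \<tau> =
     forced_all {D. dense_in_Cohen D}
       (\<lambda>D. forced_ex P r D (\<lambda>s. forced_initial_segment P r s \<tau>))"

definition adds_Cohen_real :: "'a set \<Rightarrow> 'a rel \<Rightarrow> bool" where
  "adds_Cohen_real P r \<longleftrightarrow> (\<exists>\<tau> \<subseteq> UNIV \<times> P. \<forall>p\<in>P. forced_Cohen P r \<tau> p)"


section \<open>Independence of the ambient type\<close>

unbundle cardinal_syntax

lemma finite_card_of_ordLeq:
  assumes "finite A" "infinite B"
  shows "|A| \<le>o |B|"
  using assms by (intro ordLess_imp_ordLeq finite_ordLess_infinite) (auto simp: Field_card_of card_of_well_order_on)

lemma Fpow_ordLeq_infinite:
  assumes inf: "infinite B" and S: "|S| \<le>o |B|"
  shows "|Fpow S| \<le>o |B|"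
proof -
  define L where "L n = {F. F \<subseteq> S \<and> finite F \<and> card F = n}" for n
  have "|L n| \<le>o |B|" for n
  proof (induction n)
    case 0
    have "L 0 = {{}}" by (auto simp: L_def)
    then show ?case using inf by (simp add: finite_card_of_ordLeq)
  next
    case (Suc n)
    have "L (Suc n) \<subseteq> (\<lambda>(x, F). insert x F) ` (S \<times> L n)"
    proof
      fix F assume "F \<in> L (Suc n)"
      then obtain x F' where "F = insert x F'" "x \<in> S" "F' \<in> L n"
        by (auto simp: L_def card_Suc_eq)
      then show "F \<in> (\<lambda>(x, F). insert x F) ` (S \<times> L n)" by auto
    qed
    moreover have "|S \<times> L n| \<le>o |B|"
      using card_of_Sigma_ordLeq_infinite[OF inf S, of "\<lambda>_. L n"] Suc by simp
    ultimately show ?case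
      using card_of_mono1 card_of_image ordLeq_transitive by meson
  qed
  then have "|\<Union>n\<in>UNIV. L n| \<le>o |B|"
    using inf infinite_iff_card_of_nat by (intro card_of_UNION_ordLeq_infinite) auto
  moreover have "Fpow S = (\<Union>n\<in>UNIV. L n)" by (auto simp: L_def Fpow_def)
  ultimately show ?thesis by simp
qed

lemma small_closed_subset:
  fixes \<kappa> :: "'k rel" and ub :: "'b set \<Rightarrow> 'b" and g :: "'k \<Rightarrow> 'b \<Rightarrow> 'b"
  assumes co: "Card_order \<kappa>" and inf: "infinite (Field \<kappa>)"
    and ubQ: "\<And>F. finite F \<Longrightarrow> ub F \<in> Q" and gQ: "\<And>\<alpha> q. \<alpha> \<in> Field \<kappa> \<Longrightarrow> q \<in> Q \<Longrightarrow> g \<alpha> q \<in> Q"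
    and pQ: "p \<in> Q"
  obtains S where "p \<in> S" "S \<subseteq> Q" "|S| \<le>o \<kappa>"
    "\<And>F. finite F \<Longrightarrow> F \<subseteq> S \<Longrightarrow> ub F \<in> S"
    "\<And>\<alpha> q. \<alpha> \<in> Field \<kappa> \<Longrightarrow> q \<in> S \<Longrightarrow> g \<alpha> q \<in> S"
proof -
  let ?K = "Field \<kappa>"
  have K: "|?K| =o \<kappa>" using co by (rule card_of_Field_ordIso)
  define H where "H S = S \<union> (ub ` Fpow S) \<union> (\<lambda>(\<alpha>, q). g \<alpha> q) ` (?K \<times> S)" for S
  define T where "T n = (H ^^ n) {p}" for n
  have T0: "T 0 = {p}" and TS: "T (Suc n) = H (T n)" for n by (simp_all add: T_def)
  have cH: "|H S| \<le>o |?K|" if S: "|S| \<le>o |?K|" for S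
  proof -
    have a: "|Fpow S| \<le>o |?K|" using Fpow_ordLeq_infinite[OF inf S] .
    have b: "|ub ` Fpow S| \<le>o |?K|"
      using a card_of_image ordLeq_transitive by blast
    have c: "|?K \<times> S| \<le>o |?K|"
      using card_of_Sigma_ordLeq_infinite[OF inf card_of_mono1[OF subset_refl], of "\<lambda>_. S"] S by simp
    have d: "|(\<lambda>(\<alpha>, q). g \<alpha> q) ` (?K \<times> S)| \<le>o |?K|"
      using c card_of_image ordLeq_transitive by blast
    have C: "Cinfinite |?K|" using inf by (simp add: cinfinite_def Field_card_of card_of_card_order_on)
    show ?thesis unfolding H_def by (intro Un_Cinfinite_bound S b d C)
  qed
  have cT: "|T n| \<le>o |?K|" for n
  proof (induction n)
    case 0
    show ?case unfolding T0
      using inf finite_card_of_ordLeq by blast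
  next
    case (Suc n)
    then show ?case unfolding TS by (rule cH)
  qed
  have TQ: "T n \<subseteq> Q" for n
  proof (induction n)
    case 0
    show ?case using pQ by (simp add: T0)
  next
    case (Suc n)
    then show ?case using ubQ gQ by (auto simp: TS H_def Fpow_def)
  qed
  have Tmono: "mono T"
    unfolding mono_iff_le_Suc by (auto simp: TS H_def)
  define S where "S = (\<Union>n. T n)"
  have "|UNIV :: nat set| \<le>o |?K|" using inf infinite_iff_card_of_nat by blast
  then have "|S| \<le>o |?K|" unfolding S_def
    by (intro card_of_UNION_ordLeq_infinite[OF inf]) (auto simp: cT)
  then have 1: "|S| \<le>o \<kappa>" using K ordLeq_ordIso_trans by blast
  have 2: "ub F \<in> S" if F: "finite F" "F \<subseteq> S" for F
  proof -
    have "\<exists>n. F \<subseteq> T n" using F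
    proof (induction F rule: finite_induct)
      case (insert x F)
      then obtain n m where "F \<subseteq> T n" "x \<in> T m" by (auto simp: S_def)
      then have "insert x F \<subseteq> T (max n m)"
        using monoD[OF Tmono, of n "max n m"] monoD[OF Tmono, of m "max n m"] by auto
      then show ?case by blast
    qed simp
    then obtain n where "F \<subseteq> T n" by blast
    then have "ub F \<in> T (Suc n)" using F by (auto simp: TS H_def Fpow_def)
    then show ?thesis by (auto simp: S_def)
  qed
  have 3: "g \<alpha> q \<in> S" if "\<alpha> \<in> ?K" "q \<in> S" for \<alpha> q
  proof -
    from that obtain n where "q \<in> T n" by (auto simp: S_def)
    then have "g \<alpha> q \<in> T (Suc n)" using that by (auto simp: TS H_def)
    then show ?thesis by (auto simp: S_def)
  qed
  have "p \<in> S" using T0 by (auto simp: S_def)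
  moreover have "S \<subseteq> Q" using TQ by (auto simp: S_def)
  ultimately show thesis using 1 2 3 that by blast
qed

lemma MA_class_sigma_centered_any_type:
  fixes \<kappa> :: "'k rel"
  assumes MA: "MA_class \<kappa> (sigma_centered :: 'a set \<Rightarrow> 'a rel \<Rightarrow> bool)"
    and co: "Card_order \<kappa>" and inf: "infinite (Field \<kappa>)"
    and le: "\<kappa> \<le>o |UNIV :: 'a set|"
  shows "MA_class \<kappa> (sigma_centered :: 'b set \<Rightarrow> 'b rel \<Rightarrow> bool)"
  unfolding MA_class_def MA_def
proof (intro allI impI ballI)
  fix Q :: "'b set" and r A p
  assume Q: "forcing_notion Q r \<and> sigma_centered Q r" and p: "p \<in> Q"
    and A: "\<forall>\<alpha>\<in>Field \<kappa>. maximal_antichain Q r (A \<alpha>)"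
  have rQ: "r \<subseteq> Q \<times> Q" and refl: "\<And>x. x \<in> Q \<Longrightarrow> (x, x) \<in> r" and tr: "trans r"
    using Q by (auto simp: forcing_notion_def preorder_on_def refl_on_def)
  obtain C where C: "Q = (\<Union>n::nat. C n)"
    and Cc: "\<And>n F. finite F \<Longrightarrow> F \<subseteq> C n \<Longrightarrow> \<exists>u\<in>Q. \<forall>x\<in>F. (x, u) \<in> r"
    using Q unfolding sigma_centered_def by metis
  define ub where "ub F = (if \<exists>u\<in>Q. \<forall>x\<in>F. (x, u) \<in> r then SOME u. u \<in> Q \<and> (\<forall>x\<in>F. (x, u) \<in> r) else p)" for F
  have ub: "ub F \<in> Q \<and> (\<forall>x\<in>F. (x, ub F) \<in> r)" if "\<exists>u\<in>Q. \<forall>x\<in>F. (x, u) \<in> r" for F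
    using that someI_ex[of "\<lambda>u. u \<in> Q \<and> (\<forall>x\<in>F. (x, u) \<in> r)"] by (auto simp: ub_def)
  have ubQ: "ub F \<in> Q" for F
    by (cases "\<exists>u\<in>Q. \<forall>x\<in>F. (x, u) \<in> r") (use ub p in \<open>auto simp: ub_def\<close>)
  have "\<forall>\<alpha>\<in>Field \<kappa>. \<forall>q\<in>Q. \<exists>a. a \<in> A \<alpha> \<and> a \<in> Q \<and> compatible Q r q a"
    using A unfolding maximal_antichain_def by blast
  then obtain g where g: "\<And>\<alpha> q. \<alpha> \<in> Field \<kappa> \<Longrightarrow> q \<in> Q \<Longrightarrow> g \<alpha> q \<in> A \<alpha> \<and> g \<alpha> q \<in> Q \<and> compatible Q r q (g \<alpha> q)"
    by metis
  obtain S where pS: "p \<in> S" and SQ: "S \<subseteq> Q" and cS: "|S| \<le>o \<kappa>"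
    and Sub: "\<And>F. finite F \<Longrightarrow> F \<subseteq> S \<Longrightarrow> ub F \<in> S"
    and Sg: "\<And>\<alpha> q. \<alpha> \<in> Field \<kappa> \<Longrightarrow> q \<in> S \<Longrightarrow> g \<alpha> q \<in> S"
    using small_closed_subset[OF co inf, of ub Q g p] ubQ g p by blast
  have "|S| \<le>o |UNIV :: 'a set|" using cS le ordLeq_transitive by blast
  then obtain f :: "'b \<Rightarrow> 'a" where f: "inj_on f S"
    unfolding card_of_ordLeq[symmetric] by blast
  have compS: "compatible S r x y" if "x \<in> S" "y \<in> S" "compatible Q r x y" for x y
    using ub[of "{x, y}"] Sub[of "{x, y}"] that by (auto simp: compatible_def)
  define R where "R = {(f x, f y) | x y. x \<in> S \<and> y \<in> S \<and> (x, y) \<in> r}"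
  have R: "(f x, f y) \<in> R \<longleftrightarrow> (x, y) \<in> r" if "x \<in> S" "y \<in> S" for x y
    using that f by (auto simp: R_def inj_on_def)
  have compR: "compatible (f ` S) R (f x) (f y) \<longleftrightarrow> compatible S r x y" if "x \<in> S" "y \<in> S" for x y
    using that R by (auto simp: compatible_def)
  have "trans R"
  proof (rule transI)
    fix x y z assume xy: "(x, y) \<in> R" and yz: "(y, z) \<in> R"
    from xy obtain a b where ab: "x = f a" "y = f b" "a \<in> S" "b \<in> S" "(a, b) \<in> r"
      by (auto simp: R_def)
    from yz obtain b' c where bc: "y = f b'" "z = f c" "b' \<in> S" "c \<in> S" "(b', c) \<in> r"
      by (auto simp: R_def)
    have "b' = b" using ab bc f by (auto simp: inj_on_def)
    then show "(x, z) \<in> R" using ab bc R transD[OF tr] by blast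
  qed
  moreover have "R \<subseteq> f ` S \<times> f ` S" by (auto simp: R_def)
  moreover have "refl_on (f ` S) R"
    using R refl SQ by (auto simp: refl_on_def)
  ultimately have fn: "forcing_notion (f ` S) R"
    using pS by (auto simp: forcing_notion_def preorder_on_def)
  have sc: "sigma_centered (f ` S) R"
    unfolding sigma_centered_def
  proof (intro exI conjI allI impI)
    show "f ` S = (\<Union>n. f ` (C n \<inter> S))" using SQ C by blast
    fix n F assume "finite F \<and> F \<subseteq> f ` (C n \<inter> S)"
    then obtain F' where F': "F' \<subseteq> C n \<inter> S" "finite F'" "F = f ` F'"
      by (meson finite_subset_image)
    then have "ub F' \<in> S" "\<forall>x\<in>F'. (x, ub F') \<in> r"
      using Sub ub[OF Cc[of F' n]] by auto
    then have "f (ub F') \<in> f ` S" "\<forall>x\<in>F. (x, f (ub F')) \<in> R"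
      using F' R by auto
    then show "\<exists>u\<in>f ` S. \<forall>x\<in>F. (x, u) \<in> R" by blast
  qed
  have ac: "maximal_antichain (f ` S) R (f ` (A \<alpha> \<inter> S))" if al: "\<alpha> \<in> Field \<kappa>" for \<alpha>
    unfolding maximal_antichain_def
  proof (intro conjI ballI impI)
    show "f ` (A \<alpha> \<inter> S) \<subseteq> f ` S" by blast
    fix a b assume "a \<in> f ` (A \<alpha> \<inter> S)" "b \<in> f ` (A \<alpha> \<inter> S)" "a \<noteq> b"
    then obtain x y where xy: "a = f x" "b = f y" "x \<in> A \<alpha>" "y \<in> A \<alpha>" "x \<in> S" "y \<in> S" "x \<noteq> y"
      by blast
    then have "\<not> compatible Q r x y" using A al by (auto simp: maximal_antichain_def)
    then have "\<not> compatible S r x y" using SQ by (auto simp: compatible_def)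
    then show "\<not> compatible (f ` S) R a b" using compR xy by simp
  next
    fix q assume "q \<in> f ` S"
    then obtain x where x: "q = f x" "x \<in> S" by blast
    have "compatible S r x (g \<alpha> x)" using compS g Sg al x SQ by blast
    then have "compatible (f ` S) R q (f (g \<alpha> x))" using compR x Sg al by simp
    moreover have "f (g \<alpha> x) \<in> f ` (A \<alpha> \<inter> S)" using g Sg al x SQ by blast
    ultimately show "\<exists>a\<in>f ` (A \<alpha> \<inter> S). compatible (f ` S) R q a" by blast
  qed
  have "MA \<kappa> (f ` S) R" using MA fn sc by (simp add: MA_class_def)
  then obtain G where G: "forcing_filter (f ` S) R G" and pG: "f p \<in> G"
    and GA: "\<And>\<alpha>. \<alpha> \<in> Field \<kappa> \<Longrightarrow> G \<inter> f ` (A \<alpha> \<inter> S) \<noteq> {}"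
    using ac pS unfolding MA_def
    by (elim allE[of _ "\<lambda>\<alpha>. f ` (A \<alpha> \<inter> S)"] ballE[of _ _ "f p"]) auto
  define G' where "G' = {q \<in> Q. \<exists>x\<in>S. f x \<in> G \<and> (q, x) \<in> r}"
  have in_G': "x \<in> G'" if "x \<in> S" "f x \<in> G" for x
    using that refl SQ by (auto simp: G'_def)
  have "\<exists>u\<in>G'. (x, u) \<in> r \<and> (y, u) \<in> r" if x: "x \<in> G'" and y: "y \<in> G'" for x y
  proof -
    from x obtain a where a: "a \<in> S" "f a \<in> G" "(x, a) \<in> r" by (auto simp: G'_def)
    from y obtain b where b: "b \<in> S" "f b \<in> G" "(y, b) \<in> r" by (auto simp: G'_def)
    from G a b obtain w where "w \<in> G" "(f a, w) \<in> R" "(f b, w) \<in> R"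
      unfolding forcing_filter_def by blast
    moreover from \<open>w \<in> G\<close> G obtain c where "w = f c" "c \<in> S"
      by (auto simp: forcing_filter_def)
    ultimately have "c \<in> G'" "(a, c) \<in> r" "(b, c) \<in> r" using in_G' R a b by auto
    then show ?thesis using a b transD[OF tr] by blast
  qed
  moreover have "p \<in> G'" using in_G' pS pG by blast
  moreover have "\<And>q p. q \<in> G' \<Longrightarrow> p \<in> Q \<Longrightarrow> (p, q) \<in> r \<Longrightarrow> p \<in> G'"
    using transD[OF tr] unfolding G'_def by blast
  ultimately have "forcing_filter Q r G'"
    unfolding forcing_filter_def by (auto simp: G'_def)
  moreover have "G' \<inter> A \<alpha> \<noteq> {}" if "\<alpha> \<in> Field \<kappa>" for \<alpha>
    using GA[OF that] in_G' by blast
  ultimately show "\<exists>G. forcing_filter Q r G \<and> p \<in> G \<and> (\<forall>\<alpha>\<in>Field \<kappa>. G \<inter> A \<alpha> \<noteq> {})"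
    using \<open>p \<in> G'\<close> by blast
qed

end

theory Submission
  imports Defs "HOL-Library.Countable_Set"
begin

text \<open>
  Since \<open>P\<close> is \<open>\<sigma>\<close>-linked and atomless, there are countably many maximal antichains such that
  every condition is compatible with two elements of one of them. The finite subsets \<open>e\<close> of their
  union \<open>W\<close> are read as events \<open>e \<subseteq> G\<close>. A sequence \<open>(e\<^sub>i, v\<^sub>i)\<close> of events and binary words names the
  real obtained by concatenating those \<open>v\<^sub>i\<close> for which \<open>e\<^sub>i\<close> happens. A sequence yielding a Cohen
  real is added by a \<open>\<sigma>\<close>-centered forcing: its conditions are finite sequences together with
  finitely many promises \<open>(p, s)\<close>, each of which says that below \<open>p\<close> the word read so far can still be \<open>s\<close>.
  Given a promise \<open>(p, s)\<close> and a word \<open>t\<close>, an event that is possible below \<open>p\<close> but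
  is not forced by the witnesses of any promise can be appended with the word \<open>t\<close>;
  this makes \<open>s @ t\<close> possible below \<open>p\<close> and keeps all promises. Hence a sufficiently generic
  sequence has, for every \<open>p\<close>, a word \<open>s\<close> all of whose extensions are possible below \<open>p\<close>, which is
  Cohenness; this takes only \<open>|P|\<close> many dense sets.
\<close>

section \<open>Dense sets and maximal antichains\<close>

text \<open>Zorn's lemma is applied to antichains inside \<open>D\<close>, with incompatibility
  taken in \<open>P\<close>. Such a maximal family is maximal in \<open>P\<close> too, because every
  condition extends into \<open>D\<close>.\<close>

lemma maximal_antichain_in_dense:
  assumes DP: "D \<subseteq> P" and dense: "\<And>p. p \<in> P \<Longrightarrow> \<exists>d\<in>D. (p, d) \<in> r"
    and tr: "trans r"
  obtains A where "A \<subseteq> D" "maximal_antichain P r A"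
proof -
  define S where "S = {A. A \<subseteq> D \<and> pairwise (\<lambda>a b. \<not> compatible P r a b) A}"
  have "\<exists>M\<in>S. \<forall>X\<in>S. M \<subseteq> X \<longrightarrow> X = M"
  proof (rule subset_Zorn')
    fix C assume "subset.chain S C"
    then have "C \<subseteq> S" "\<forall>X\<in>C. \<forall>Y\<in>C. X \<subseteq> Y \<or> Y \<subseteq> X"
      by (auto simp: subset_chain_def)
    then show "\<Union>C \<in> S" unfolding S_def
      by (auto intro!: pairwise_chain_Union simp: chain_subset_def)
  qed
  then obtain M where M: "M \<in> S" and max: "\<And>X. X \<in> S \<Longrightarrow> M \<subseteq> X \<Longrightarrow> X = M" by blast
  have "\<exists>a\<in>M. compatible P r p a" if p: "p \<in> P" for p
  proof -
    obtain d where d: "d \<in> D" "(p, d) \<in> r" using dense[OF p] by blast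
    have "\<exists>a\<in>M. compatible P r d a"
    proof (rule ccontr)
      assume not: "\<not> ?thesis"
      then have "insert d M \<in> S"
        using M d by (auto simp: S_def pairwise_insert compatible_def)
      then have "d \<in> M" using max by blast
      \<comment> \<open>A condition of \<open>D\<close> beyond \<open>d\<close> serves as the common
        bound.\<close>
      moreover have "compatible P r d d" using dense[of d] d DP by (auto simp: compatible_def)
      ultimately show False using not by blast
    qed
    then show ?thesis using d tr by (meson compatible_def transD)
  qed
  then have "maximal_antichain P r M"
    using M DP by (auto simp: maximal_antichain_def S_def pairwise_def)
  then show thesis using M that by (auto simp: S_def)
qed

text \<open>Martin's axiom is stated for antichains; each dense set is replaced by a maximal
  antichain inside it, and \<open>I\<close> is reindexed by \<open>Field \<kappa>\<close>.\<close>

lemma MA_dense: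
  fixes \<kappa> :: "'k rel" and D :: "'i \<Rightarrow> 'a set"
  assumes MA: "MA \<kappa> P r" and tr: "trans r" and p: "p \<in> P"
    and co: "Card_order \<kappa>" and I: "|I| \<le>o \<kappa>" and ne: "I \<noteq> {}"
    and DP: "\<And>i. i \<in> I \<Longrightarrow> D i \<subseteq> P"
    and dense: "\<And>i q. i \<in> I \<Longrightarrow> q \<in> P \<Longrightarrow> \<exists>d\<in>D i. (q, d) \<in> r"
  obtains G where "forcing_filter P r G" "\<And>i. i \<in> I \<Longrightarrow> G \<inter> D i \<noteq> {}"
proof -
  have "|I| \<le>o |Field \<kappa>|"
    using I card_of_Field_ordIso[OF co] ordIso_symmetric ordLeq_ordIso_trans by blast
  then obtain f where f: "I \<subseteq> f ` Field \<kappa>"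
    by (metis card_of_ordLeq2 ne order_refl)
  have "\<forall>i\<in>I. \<exists>A. A \<subseteq> D i \<and> maximal_antichain P r A"
    using maximal_antichain_in_dense[OF DP dense tr] by metis
  then obtain A where A: "\<And>i. i \<in> I \<Longrightarrow> A i \<subseteq> D i \<and> maximal_antichain P r (A i)" by metis
  obtain i0 where i0: "i0 \<in> I" using ne by blast
  \<comment> \<open>The map \<open>f\<close> only has to cover \<open>I\<close>; indices sent
    outside \<open>I\<close> get the default \<open>i0\<close>.\<close>
  define B where "B \<alpha> = A (if f \<alpha> \<in> I then f \<alpha> else i0)" for \<alpha>
  have "\<forall>\<alpha>\<in>Field \<kappa>. maximal_antichain P r (B \<alpha>)" using A i0 by (simp add: B_def)
  then obtain G where G: "forcing_filter P r G" "\<forall>\<alpha>\<in>Field \<kappa>. G \<inter> B \<alpha> \<noteq> {}"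
    using MA p unfolding MA_def by metis
  have "G \<inter> D i \<noteq> {}" if i: "i \<in> I" for i
  proof -
    obtain \<alpha> where al: "\<alpha> \<in> Field \<kappa>" "f \<alpha> = i" using f i by blast
    then have "B \<alpha> \<subseteq> D i" using A i by (simp add: B_def)
    then show ?thesis using G al by blast
  qed
  then show thesis using G that by blast
qed

lemma compatible_weaken:
  assumes "trans r" "compatible P r p' q" "(p, p') \<in> r"
  shows "compatible P r p q"
  using assms by (meson compatible_def transD)

text \<open>Each linked piece contains at most one element of an antichain.\<close>

lemma sigma_linked_antichain_countable:
  assumes "sigma_linked P r" "maximal_antichain P r A"
  shows "countable A"
proof -
  obtain L :: "nat \<Rightarrow> 'a set" where L: "P = (\<Union>n. L n)"
    "\<And>n p q. p \<in> L n \<Longrightarrow> q \<in> L n \<Longrightarrow> compatible P r p q"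
    using assms by (auto simp: sigma_linked_def)
  then have "\<forall>a\<in>A. \<exists>n. a \<in> L n" using assms by (auto simp: maximal_antichain_def)
  then obtain f where f: "\<And>a. a \<in> A \<Longrightarrow> a \<in> L (f a)" by metis
  have "inj_on f A"
  proof (rule inj_onI, rule ccontr)
    fix a b assume "a \<in> A" "b \<in> A" "f a = f b" "a \<noteq> b"
    then show False using L(2)[of a "f a" b] f[of a] f[of b] assms by (auto simp: maximal_antichain_def)
  qed
  then show ?thesis by (rule countableI)
qed

text \<open>In a finite forcing notion, passing to one of two incompatible extensions strictly
  shrinks the set of extensions, since it loses the other one.\<close>

lemma atomless_infinite:
  assumes fn: "forcing_notion P r" and al: "atomless P r"
  shows "infinite P"
proof
  assume fin: "finite P"
  define up where "up p = {q \<in> P. (p, q) \<in> r}" for p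
  have refl: "\<And>x. x \<in> P \<Longrightarrow> (x, x) \<in> r" and tr: "trans r"
    using fn by (auto simp: forcing_notion_def preorder_on_def refl_on_def)
  have "False" if "p \<in> P" for p
    using that
  proof (induction "card (up p)" arbitrary: p rule: less_induct)
    case less
    obtain q q' where q: "q \<in> P" "q' \<in> P" "(p, q) \<in> r" "(p, q') \<in> r" "\<not> compatible P r q q'"
      using al less.prems by (auto simp: atomless_def)
    have "q' \<notin> up q" using q refl by (auto simp: up_def compatible_def)
    moreover have "q' \<in> up p" "up q \<subseteq> up p" using q tr by (auto simp: up_def dest: transD)
    moreover have "finite (up p)" using fin by (simp add: up_def)
    ultimately have "card (up q) < card (up p)" by (intro psubset_card_mono) auto
    then show ?case using less.hyps q by blast
  qed
  then show False using fn by (auto simp: forcing_notion_def)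
qed

text \<open>The \<open>n\<close>-th antichain consists of conditions that no element of the \<open>n\<close>-th linked piece forces into \<open>G\<close>.\<close>

lemma splitting_antichains:
  assumes fn: "forcing_notion P r" and sl: "sigma_linked P r" and al: "atomless P r"
  obtains A :: "nat \<Rightarrow> 'a set" where "\<And>n. maximal_antichain P r (A n)"
    "\<And>p. p \<in> P \<Longrightarrow> \<exists>n. \<exists>a\<in>A n. \<exists>b\<in>A n. a \<noteq> b \<and> compatible P r p a \<and> compatible P r p b"
proof -
  have refl: "\<And>x. x \<in> P \<Longrightarrow> (x, x) \<in> r" and tr: "trans r"
    using fn by (auto simp: forcing_notion_def preorder_on_def refl_on_def)
  obtain L :: "nat \<Rightarrow> 'a set" where L: "P = (\<Union>n. L n)"
    "\<And>n p q. p \<in> L n \<Longrightarrow> q \<in> L n \<Longrightarrow> compatible P r p q"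
    using sl by (auto simp: sigma_linked_def)
  define forces where "forces l q \<longleftrightarrow> (\<forall>u\<in>P. (l, u) \<in> r \<longrightarrow> compatible P r u q)" for l q
  define E where "E n = {q \<in> P. \<forall>l\<in>L n. \<not> forces l q}" for n
  \<comment> \<open>If neither of two incompatible extensions of \<open>p\<close> lies in
    \<open>E n\<close>, each is forced by a member of \<open>L n\<close>. These two members are
    linked, so a common extension of them forces both, which is impossible.\<close>
  have dense: "\<exists>d\<in>E n. (p, d) \<in> r" if p: "p \<in> P" for n p
  proof (rule ccontr)
    assume not: "\<not> ?thesis"
    obtain q q' where q: "q \<in> P" "q' \<in> P" "(p, q) \<in> r" "(p, q') \<in> r" "\<not> compatible P r q q'"
      using al p by (auto simp: atomless_def)
    then have "q \<notin> E n" "q' \<notin> E n" using not by auto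
    then obtain l l' where l: "l \<in> L n" "forces l q" "l' \<in> L n" "forces l' q'"
      using q by (auto simp: E_def)
    then obtain u where u: "u \<in> P" "(l, u) \<in> r" "(l', u) \<in> r"
      using L(2)[of l n l'] by (auto simp: compatible_def)
    then obtain v where v: "v \<in> P" "(u, v) \<in> r" "(q, v) \<in> r"
      using l by (auto simp: forces_def compatible_def)
    then have "(l', v) \<in> r" using u tr by (meson transD)
    then have "compatible P r v q'" using l v by (auto simp: forces_def)
    then show False using compatible_weaken[OF tr] v q by blast
  qed
  have "\<forall>n. \<exists>A. A \<subseteq> E n \<and> maximal_antichain P r A"
    using maximal_antichain_in_dense[OF _ dense tr] E_def by (metis (no_types, lifting) mem_Collect_eq subsetI)
  then obtain A where A: "\<And>n. A n \<subseteq> E n" "\<And>n. maximal_antichain P r (A n)" by metis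
  have "\<exists>n. \<exists>a\<in>A n. \<exists>b\<in>A n. a \<noteq> b \<and> compatible P r p a \<and> compatible P r p b" if p: "p \<in> P" for p
  proof -
    obtain n where n: "p \<in> L n" using p L by blast
    obtain a where a: "a \<in> A n" "compatible P r p a"
      using A(2)[of n] p by (auto simp: maximal_antichain_def)
    \<comment> \<open>As \<open>p\<close> lies in \<open>L n\<close>, it does not force
      \<open>a\<close>. Some extension \<open>u\<close> therefore excludes \<open>a\<close>, and the
      element of \<open>A n\<close> compatible with \<open>u\<close> is the second one.\<close>
    then obtain u where u: "u \<in> P" "(p, u) \<in> r" "\<not> compatible P r u a"
      using A(1)[of n] n by (auto simp: E_def forces_def)
    then obtain b where b: "b \<in> A n" "compatible P r u b"
      using A(2)[of n] by (auto simp: maximal_antichain_def)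
    moreover have "compatible P r p b" using compatible_weaken[OF tr b(2) u(2)] .
    moreover have "a \<noteq> b" using b u by blast
    ultimately show ?thesis using a by blast
  qed
  then show thesis using A that by blast
qed


section \<open>Events\<close>

text \<open>\<open>meets\<close> and \<open>avoids\<close> ensure that every filter containing
  \<open>q\<close> includes \<open>e\<close>, respectively fails to include it.\<close>

definition meets :: "'a rel \<Rightarrow> 'a \<Rightarrow> 'a set \<Rightarrow> bool" where
  "meets r q e \<longleftrightarrow> (\<forall>a\<in>e. (a, q) \<in> r)"

definition avoids :: "'a set \<Rightarrow> 'a rel \<Rightarrow> 'a \<Rightarrow> 'a set \<Rightarrow> bool" where
  "avoids P r q e \<longleftrightarrow> (\<exists>a\<in>e. \<not> compatible P r q a)"

definition decides :: "'a set \<Rightarrow> 'a rel \<Rightarrow> ('a set \<times> bool list) list \<Rightarrow> 'a \<Rightarrow> bool" where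
  "decides P r st q \<longleftrightarrow> (\<forall>(e, v)\<in>set st. meets r q e \<or> avoids P r q e)"

text \<open>An undecided event contributes nothing, so stability under extension is guaranteed only
  where \<open>decides\<close> holds.\<close>

definition word :: "'a rel \<Rightarrow> ('a set \<times> bool list) list \<Rightarrow> 'a \<Rightarrow> bool list" where
  "word r st q = concat (map (\<lambda>(e, v). if meets r q e then v else []) st)"

lemma decides_append [simp]: "decides P r (st @ st') q \<longleftrightarrow> decides P r st q \<and> decides P r st' q"
  by (auto simp: decides_def)

lemma word_append [simp]: "word r (st @ st') q = word r st q @ word r st' q"
  by (simp add: word_def)

lemma word_prefix: "prefix st st' \<Longrightarrow> prefix (word r st q) (word r st' q)"
  by (auto simp: prefix_def)

context
  fixes P :: "'a set" and r :: "'a rel"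
  assumes fn: "forcing_notion P r"
begin

lemma forcing_refl: "x \<in> P \<Longrightarrow> (x, x) \<in> r"
  and forcing_trans: "trans r"
  and forcing_subset: "(x, y) \<in> r \<Longrightarrow> x \<in> P \<and> y \<in> P"
  using fn by (auto simp: forcing_notion_def preorder_on_def refl_on_def)

lemma meets_mono: "meets r q e \<Longrightarrow> (q, q') \<in> r \<Longrightarrow> meets r q' e"
  using forcing_trans by (meson meets_def transD)

lemma avoids_mono: "avoids P r q e \<Longrightarrow> (q, q') \<in> r \<Longrightarrow> avoids P r q' e"
  using compatible_weaken[OF forcing_trans] by (meson avoids_def)

lemma meets_not_avoids: "q \<in> P \<Longrightarrow> meets r q e \<Longrightarrow> \<not> avoids P r q e"
  using forcing_refl by (auto simp: meets_def avoids_def compatible_def)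

lemma decides_mono: "decides P r st q \<Longrightarrow> (q, q') \<in> r \<Longrightarrow> decides P r st q'"
  using meets_mono avoids_mono by (fastforce simp: decides_def)

lemma word_mono:
  assumes "decides P r st q" "(q, q') \<in> r"
  shows "word r st q' = word r st q"
proof -
  have "meets r q' e \<longleftrightarrow> meets r q e" if "(e, v) \<in> set st" for e v
    using assms that meets_mono avoids_mono meets_not_avoids forcing_subset by (fastforce simp: decides_def)
  then show ?thesis unfolding word_def by (intro arg_cong[of _ _ concat] map_cong) auto
qed

text \<open>The elements of \<open>e\<close> are absorbed one at a time, until one of them is
  incompatible with the condition reached.\<close>

lemma meets_or_avoids_dense:
  assumes "q \<in> P" "finite e"
  shows "\<exists>u\<in>P. (q, u) \<in> r \<and> (meets r u e \<or> avoids P r u e)"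
  using assms(2)
proof (induction e rule: finite_induct)
  case empty
  then show ?case using assms forcing_refl by (auto simp: meets_def)
next
  case (insert a e)
  then obtain u where u: "u \<in> P" "(q, u) \<in> r" "meets r u e \<or> avoids P r u e" by blast
  show ?case
  proof (cases "compatible P r u a \<and> meets r u e")
    case True
    then obtain v where "v \<in> P" "(u, v) \<in> r" "(a, v) \<in> r" by (auto simp: compatible_def)
    then have "v \<in> P" "(q, v) \<in> r" "meets r v (insert a e)"
      using u True meets_mono[of u e v] transD[OF forcing_trans] by (auto simp: meets_def)
    then show ?thesis by blast
  next
    case False
    then have "avoids P r u (insert a e)" using u by (auto simp: avoids_def)
    then show ?thesis using u by blast
  qed
qed

lemma decides_dense:
  assumes "q \<in> P" "\<forall>(e, v)\<in>set st. finite e"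
  shows "\<exists>u\<in>P. (q, u) \<in> r \<and> decides P r st u"
  using assms(2)
proof (induction st)
  case Nil
  then show ?case using assms forcing_refl by (auto simp: decides_def)
next
  case (Cons x st)
  then obtain u where u: "u \<in> P" "(q, u) \<in> r" "decides P r st u" by auto
  obtain e v where x: "x = (e, v)" by force
  then obtain w where w: "w \<in> P" "(u, w) \<in> r" "meets r w e \<or> avoids P r w e"
    using meets_or_avoids_dense[OF u(1)] Cons.prems by auto
  then have "decides P r (x # st) w" "(q, w) \<in> r"
    using decides_mono[of st u w] u x transD[OF forcing_trans] by (auto simp: decides_def)
  then show ?case using w by blast
qed

text \<open>The event gains one element per \<open>h\<close>. Of two elements of some
  \<open>A n\<close> compatible with \<open>u\<close>, at least one differs from an element
  \<open>c\<close> of \<open>A n\<close> compatible with \<open>h\<close>; adding it keeps the event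
  possible, while an extension of \<open>h\<close> and \<open>c\<close> avoids it.\<close>

lemma possible_unforced_event:
  fixes A :: "nat \<Rightarrow> 'a set"
  assumes A: "\<And>n. maximal_antichain P r (A n)"
    and split: "\<And>p. p \<in> P \<Longrightarrow>
      \<exists>n. \<exists>a\<in>A n. \<exists>b\<in>A n. a \<noteq> b \<and> compatible P r p a \<and> compatible P r p b"
    and q: "q \<in> P" and H: "finite H" "H \<subseteq> P"
  shows "\<exists>e. finite e \<and> e \<subseteq> (\<Union>n. A n) \<and> (\<exists>u\<in>P. (q, u) \<in> r \<and> meets r u e) \<and>
    (\<forall>h\<in>H. \<exists>u\<in>P. (h, u) \<in> r \<and> avoids P r u e)"
  using H
proof (induction H rule: finite_induct)
  case empty
  show ?case using q forcing_refl by (intro exI[of _ "{}"]) (auto simp: meets_def)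
next
  case (insert h H)
  then obtain e u where e: "finite e" "e \<subseteq> (\<Union>n. A n)" "u \<in> P" "(q, u) \<in> r" "meets r u e"
    "\<forall>h\<in>H. \<exists>u\<in>P. (h, u) \<in> r \<and> avoids P r u e" by blast
  obtain n a b where ab: "a \<in> A n" "b \<in> A n" "a \<noteq> b" "compatible P r u a" "compatible P r u b"
    using split[OF e(3)] by blast
  obtain c where c: "c \<in> A n" "compatible P r h c"
    using A[of n] insert.prems by (auto simp: maximal_antichain_def)
  obtain d where d: "d \<in> A n" "d \<noteq> c" "compatible P r u d" using ab by blast
  obtain w where w: "w \<in> P" "(h, w) \<in> r" "(c, w) \<in> r" using c by (auto simp: compatible_def)
  have "\<not> compatible P r c d" using A[of n] c d by (auto simp: maximal_antichain_def)
  then have aw: "avoids P r w (insert d e)"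
    using compatible_weaken[OF forcing_trans _ w(3)] by (auto simp: avoids_def)
  obtain v where v: "v \<in> P" "(u, v) \<in> r" "(d, v) \<in> r" using d by (auto simp: compatible_def)
  have mv: "meets r v (insert d e)" using meets_mono[OF e(5) v(2)] v by (auto simp: meets_def)
  have qv: "(q, v) \<in> r" using e v forcing_trans by (meson transD)
  have "\<forall>h\<in>insert h H. \<exists>u\<in>P. (h, u) \<in> r \<and> avoids P r u (insert d e)"
    using e(6) w aw by (auto simp: avoids_def)
  then show ?case using e(1,2) d v mv qv by (intro exI[of _ "insert d e"]) blast
qed

end


section \<open>The \<open>\<sigma>\<close>-centered forcing\<close>

type_synonym 'a cond = "('a set \<times> bool list) list \<times> ('a \<times> bool list) set"

definition promise_cond :: "'a set \<Rightarrow> 'a rel \<Rightarrow> 'a set \<Rightarrow> 'a cond set" where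
  "promise_cond P r W = {(st, F). st \<in> lists (Fpow W \<times> UNIV) \<and> finite F \<and> F \<subseteq> P \<times> UNIV \<and>
     (\<forall>(p, s)\<in>F. \<exists>q\<in>P. (p, q) \<in> r \<and> decides P r st q \<and> word r st q = s)}"

text \<open>Membership of the stronger condition in \<open>promise_cond\<close> is what restricts
  longer stems: each old promise \<open>(p, s)\<close> must still have a witness whose word is
  exactly \<open>s\<close>.\<close>

definition promise_order :: "'a set \<Rightarrow> 'a rel \<Rightarrow> 'a set \<Rightarrow> 'a cond rel" where
  "promise_order P r W = {(c, d). c \<in> promise_cond P r W \<and> d \<in> promise_cond P r W \<and>
     prefix (fst c) (fst d) \<and> snd c \<subseteq> snd d}"

lemma trans_promise_order: "trans (promise_order P r W)"
  by (auto simp: trans_def promise_order_def dest: prefix_order.trans)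

lemma empty_promise_cond: "([], {}) \<in> promise_cond P r W"
  by (simp add: promise_cond_def)

lemma forcing_notion_promise: "forcing_notion (promise_cond P r W) (promise_order P r W)"
proof -
  have "promise_cond P r W \<noteq> {}" using empty_promise_cond by blast
  then show ?thesis
    using trans_promise_order by (auto simp: forcing_notion_def preorder_on_def refl_on_def promise_order_def)
qed

text \<open>Finitely many conditions with the same stem are bounded by that stem with the union of
  their promises, and a countable \<open>W\<close> allows only countably many stems.\<close>

lemma sigma_centered_promise:
  assumes "countable W"
  shows "sigma_centered (promise_cond P r W) (promise_order P r W)"
proof -
  let ?Q = "promise_cond P r W"
  define S :: "('a set \<times> bool list) list set" where "S = lists (Fpow W \<times> UNIV)"
  have cS: "countable S" unfolding S_def Fpow_def
    using countable_Collect_finite_subset[OF assms] by (simp add: conj_commute)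
  have "S \<noteq> {}" by (auto simp: S_def)
  then have S: "range (from_nat_into S) = S" using cS by (rule range_from_nat_into)
  show ?thesis unfolding sigma_centered_def
  proof (intro exI conjI allI impI)
    show "?Q = (\<Union>n. {c \<in> ?Q. fst c = from_nat_into S n})"
    proof -
      have "\<exists>n. fst c = from_nat_into S n" if "c \<in> ?Q" for c
      proof -
        have "fst c \<in> S" using that by (auto simp: promise_cond_def S_def)
        then show ?thesis using S by (metis rangeE)
      qed
      then show ?thesis by blast
    qed
    fix n X assume X: "finite X \<and> X \<subseteq> {c \<in> ?Q. fst c = from_nat_into S n}"
    define u where "u = (from_nat_into S n, \<Union>(snd ` X))"
    have st: "from_nat_into S n \<in> lists (Fpow W \<times> UNIV)" using S S_def by blast
    have "u \<in> ?Q" unfolding u_def promise_cond_def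
      using X st by (fastforce simp: promise_cond_def)
    then have "\<forall>c\<in>X. (c, u) \<in> promise_order P r W"
      using X by (auto simp: promise_order_def u_def)
    then show "\<exists>u\<in>?Q. \<forall>c\<in>X. (c, u) \<in> promise_order P r W" using \<open>u \<in> ?Q\<close> by blast
  qed
qed

section \<open>The name of the real and the requirements that make it Cohen\<close>

definition promise_name ::
  "'a set \<Rightarrow> 'a rel \<Rightarrow> 'a cond set \<Rightarrow> (nat \<times> 'a) set" where
  "promise_name P r G = {(i, q). q \<in> P \<and> (\<exists>c\<in>G. decides P r (fst c) q \<and>
     i < length (word r (fst c) q) \<and> word r (fst c) q ! i)}"

context
  fixes P :: "'a set" and r :: "'a rel"
  assumes fn: "forcing_notion P r"
begin

text \<open>An extension \<open>q\<close> of \<open>p\<close> deciding the stem exists, and the word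
  already read at \<open>q\<close> can be promised with \<open>q\<close> itself as witness.\<close>

lemma promise_dense:
  assumes c: "c \<in> promise_cond P r W" and p: "p \<in> P"
  obtains d s where "(c, d) \<in> promise_order P r W" "(p, s) \<in> snd d"
proof -
  obtain st F where cF: "c = (st, F)" by force
  have "\<forall>(e, v)\<in>set st. finite e" using c cF by (auto simp: promise_cond_def Fpow_def)
  then obtain q where q: "q \<in> P" "(p, q) \<in> r" "decides P r st q" using decides_dense[OF fn p] by blast
  define d where "d = (st, insert (p, word r st q) F)"
  have "d \<in> promise_cond P r W" using c q p by (auto simp: d_def cF promise_cond_def)
  then have "(c, d) \<in> promise_order P r W" using c by (auto simp: promise_order_def d_def cF)
  then show thesis by (rule that[where s = "word r st q"]) (simp add: d_def)
qed

text \<open>The stem grows by \<open>(e, t)\<close>, where \<open>e\<close> is possible beyond the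
  witness of \<open>(p, s)\<close> but avoidable beyond every witness. Meeting \<open>e\<close>
  yields \<open>s @ t\<close>; avoiding it leaves each promised word unchanged.\<close>

lemma promise_realize:
  fixes A :: "nat \<Rightarrow> 'a set"
  assumes A: "\<And>n. maximal_antichain P r (A n)"
    and split: "\<And>p. p \<in> P \<Longrightarrow>
      \<exists>n. \<exists>a\<in>A n. \<exists>b\<in>A n. a \<noteq> b \<and> compatible P r p a \<and> compatible P r p b"
    and W: "W = (\<Union>n. A n)"
    and c: "c \<in> promise_cond P r W" and ps: "(p, s) \<in> snd c"
  obtains d q where "(c, d) \<in> promise_order P r W"
    "q \<in> P" "(p, q) \<in> r" "decides P r (fst d) q" "word r (fst d) q = s @ t"
proof -
  obtain st F where cF: "c = (st, F)" by force
  have F: "finite F" "\<forall>x\<in>F. \<exists>q\<in>P. (fst x, q) \<in> r \<and> decides P r st q \<and> word r st q = snd x"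
    using c by (auto simp: cF promise_cond_def)
  then obtain w where w: "\<And>x. x \<in> F \<Longrightarrow>
      w x \<in> P \<and> (fst x, w x) \<in> r \<and> decides P r st (w x) \<and> word r st (w x) = snd x"
    by metis
  have psF: "(p, s) \<in> F" using ps cF by simp
  obtain e u where e: "finite e" "e \<subseteq> W" and u: "u \<in> P" "(w (p, s), u) \<in> r" "meets r u e"
    and av: "\<forall>h\<in>w ` F. \<exists>u\<in>P. (h, u) \<in> r \<and> avoids P r u e"
    using possible_unforced_event[OF fn A split, of "w (p, s)" "w ` F"] w psF F(1) W by blast
  define d where "d = (st @ [(e, t)], F)"
  have "\<exists>q\<in>P. (fst x, q) \<in> r \<and> decides P r (fst d) q \<and> word r (fst d) q = snd x" if x: "x \<in> F" for x
  proof -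
    obtain q where q: "q \<in> P" "(w x, q) \<in> r" "avoids P r q e" using av x by blast
    then have "decides P r st q" "word r st q = snd x" "\<not> meets r q e"
      using decides_mono[OF fn] word_mono[OF fn] meets_not_avoids[OF fn] w[OF x] by auto
    moreover have "(fst x, q) \<in> r" using w[OF x] q transD[OF forcing_trans[OF fn]] by blast
    ultimately show ?thesis using q by (auto simp: d_def decides_def word_def)
  qed
  then have "d \<in> promise_cond P r W"
    using c e by (fastforce simp: d_def cF promise_cond_def Fpow_def)
  then have "(c, d) \<in> promise_order P r W" using c by (auto simp: promise_order_def d_def cF)
  moreover have "(p, u) \<in> r" using w[OF psF] u transD[OF forcing_trans[OF fn]] by auto
  moreover have "decides P r (fst d) u" "word r (fst d) u = s @ t"
    using w[OF psF] u decides_mono[OF fn, of st "w (p, s)" u] word_mono[OF fn, of st "w (p, s)" u]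
    by (auto simp: d_def decides_def word_def)
  ultimately show thesis using that u by blast
qed

text \<open>Stems of conditions in \<open>G\<close> are prefixes of a common stem, so the words they
  decide agree wherever both are defined. No other stem can therefore put a digit into the name
  where this word has \<open>False\<close>.\<close>

lemma forced_initial_segment_promise_name:
  assumes G: "forcing_filter (promise_cond P r W) (promise_order P r W) G"
    and c: "c \<in> G" and q: "q \<in> P" and dc: "decides P r (fst c) q" and t: "prefix t (word r (fst c) q)"
  shows "forced_initial_segment P r t (promise_name P r G) q"
proof -
  have nth: "t ! i = word r (fst c) q ! i \<and> i < length (word r (fst c) q)" if "i < length t" for i
    using t that by (auto simp: prefix_def nth_append)
  have "forced_mem P r i (promise_name P r G) q" if i: "i < length t" "t ! i" for i
  proof -
    have "(i, q) \<in> promise_name P r G" using nth i q c dc by (auto simp: promise_name_def)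
    then show ?thesis using forcing_refl[OF fn] by (auto simp: forced_mem_def)
  qed
  moreover have "forced_not P r (forced_mem P r i (promise_name P r G)) q"
    if i: "i < length t" "\<not> t ! i" for i
    unfolding forced_not_def
  proof (intro ballI impI notI)
    fix q' assume q': "q' \<in> P" "(q, q') \<in> r" "forced_mem P r i (promise_name P r G) q'"
    then obtain v z where v: "v \<in> P" "(q', v) \<in> r" "(i, z) \<in> promise_name P r G" "(z, v) \<in> r"
      using forcing_refl[OF fn] unfolding forced_mem_def by blast
    then obtain d where d: "d \<in> G" "decides P r (fst d) z" "i < length (word r (fst d) z)"
      "word r (fst d) z ! i" by (auto simp: promise_name_def)
    obtain g where "(c, g) \<in> promise_order P r W" "(d, g) \<in> promise_order P r W"
      using G c d(1) unfolding forcing_filter_def by blast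
    then have "prefix (word r (fst c) v) (word r (fst g) v)" "prefix (word r (fst d) v) (word r (fst g) v)"
      by (auto simp: promise_order_def word_prefix)
    moreover have "word r (fst c) v = word r (fst c) q"
      using word_mono[OF fn dc] q' v transD[OF forcing_trans[OF fn]] by blast
    moreover have "word r (fst d) v = word r (fst d) z"
      using word_mono[OF fn d(2)] v by blast
    ultimately have "word r (fst c) q ! i = word r (fst d) z ! i"
      using nth[OF i(1)] d(3) by (metis nth_append prefix_def)
    then show False using nth i d by simp
  qed
  ultimately show ?thesis by (auto simp: forced_initial_segment_def forced_all_def)
qed

end

section \<open>Martin's axiom applied to the promise forcing\<close>

theorem theorem1p2:
  fixes \<kappa> :: "'k rel" and P :: "'a set" and r :: "'a rel"
  assumes "Card_order \<kappa>"
    and "MA_class \<kappa> (sigma_centered :: 'a set \<Rightarrow> 'a rel \<Rightarrow> bool)"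
    and "forcing_notion P r"
    and "sigma_linked P r"
    and "atomless P r"
    and "|P| =o \<kappa>"
  shows "adds_Cohen_real P r"
proof -
  note fn = assms(3)
  have infP: "infinite P" using atomless_infinite assms by blast
  have Pk: "|P| \<le>o \<kappa>" using assms(6) by (rule ordIso_imp_ordLeq)
  have inf: "infinite (Field \<kappa>)"
    using infP card_of_ordIso_finite[of P "Field \<kappa>"] card_of_Field_ordIso[OF assms(1)] assms(6)
      ordIso_symmetric ordIso_transitive by blast
  have "\<kappa> \<le>o |UNIV :: 'a set|"
    using assms(6) card_of_mono1[of P UNIV] ordIso_symmetric ordIso_ordLeq_trans by blast
  \<comment> \<open>The assumed axiom concerns carriers in \<open>'a\<close>, whereas the promise
    forcing lives in \<open>'a cond\<close>; the transfer uses that \<open>\<kappa>\<close> is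
    infinite and no larger than \<open>'a\<close>.\<close>
  then have MA: "MA_class \<kappa> (sigma_centered :: 'a cond set \<Rightarrow> 'a cond rel \<Rightarrow> bool)"
    using MA_class_sigma_centered_any_type assms(1,2) inf by blast
  obtain A :: "nat \<Rightarrow> 'a set" where A: "\<And>n. maximal_antichain P r (A n)"
    and split: "\<And>p. p \<in> P \<Longrightarrow>
      \<exists>n. \<exists>a\<in>A n. \<exists>b\<in>A n. a \<noteq> b \<and> compatible P r p a \<and> compatible P r p b"
    using splitting_antichains[OF assms(3-5)] by metis
  define W where "W = (\<Union>n. A n)"
  have "countable W" using sigma_linked_antichain_countable[OF assms(4) A] by (auto simp: W_def)
  let ?Q = "promise_cond P r W" and ?R = "promise_order P r W"
  have MAQ: "MA \<kappa> ?Q ?R"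
    using MA forcing_notion_promise sigma_centered_promise[OF \<open>countable W\<close>]
    unfolding MA_class_def by blast
  \<comment> \<open>\<open>None\<close> asks for some promise at \<open>p\<close>;
    \<open>Some (s, t)\<close> asks that \<open>s @ t\<close> become possible at an extension of
    \<open>p\<close>. The second disjunct admits conditions that rule out the promise
    \<open>(p, s)\<close>, which makes the set dense.\<close>
  define D :: "'a \<times> (bool list \<times> bool list) option \<Rightarrow> 'a cond set" where
    "D = (\<lambda>(p, x). case x of
        None \<Rightarrow> {c \<in> ?Q. \<exists>s. (p, s) \<in> snd c}
      | Some (s, t) \<Rightarrow> {c \<in> ?Q.
          (\<exists>q\<in>P. (p, q) \<in> r \<and> decides P r (fst c) q \<and> word r (fst c) q = s @ t) \<or>
          (\<forall>d. (c, d) \<in> ?R \<longrightarrow> (p, s) \<notin> snd d)})"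
  let ?I = "P \<times> (UNIV :: (bool list \<times> bool list) option set)"
  \<comment> \<open>There are countably many pairs of words and \<open>P\<close> is infinite, so at
    most \<open>\<kappa>\<close> requirements arise.\<close>
  have "|UNIV :: (bool list \<times> bool list) option set| \<le>o |P|"
    using infP by (meson countableI_type countable_def card_of_ordLeq infinite_iff_card_of_nat
      ordLeq_transitive subset_UNIV)
  then have "|?I| \<le>o |P|"
    using card_of_Sigma_ordLeq_infinite[OF infP card_of_mono1[OF subset_refl],
        of "\<lambda>_. UNIV :: (bool list \<times> bool list) option set"] by simp
  then have I: "|?I| \<le>o \<kappa>" using Pk ordLeq_transitive by blast
  have dense: "\<exists>d\<in>D i. (c, d) \<in> ?R" if i: "i \<in> ?I" and c: "c \<in> ?Q" for i c
  proof -
    obtain p x where px: "i = (p, x)" "p \<in> P" using i by blast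
    show ?thesis
    proof (cases x)
      case None
      obtain d s where "(c, d) \<in> ?R" "(p, s) \<in> snd d" by (rule promise_dense[OF fn c px(2)])
      then have "d \<in> D i" using None px by (auto simp: D_def promise_order_def)
      then show ?thesis using \<open>(c, d) \<in> ?R\<close> by blast
    next
      case (Some st)
      obtain s t where x: "x = Some (s, t)" using Some by (cases st) auto
      show ?thesis
      proof (cases "\<exists>d. (c, d) \<in> ?R \<and> (p, s) \<in> snd d")
        case True
        then obtain d where d: "(c, d) \<in> ?R" "d \<in> ?Q" "(p, s) \<in> snd d"
          by (auto simp: promise_order_def)
        obtain d' q where d': "(d, d') \<in> ?R" "q \<in> P" "(p, q) \<in> r" "decides P r (fst d') q"
          "word r (fst d') q = s @ t"
          by (rule promise_realize[OF fn A split W_def d(2,3)])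
        have "d' \<in> D i" using d' px x by (auto simp: D_def promise_order_def)
        moreover have "(c, d') \<in> ?R" using trans_promise_order d(1) d'(1) by (rule transD)
        ultimately show ?thesis by blast
      next
        case False
        then have "c \<in> D i" using px x c by (auto simp: D_def)
        moreover have "(c, c) \<in> ?R" using c by (simp add: promise_order_def)
        ultimately show ?thesis by blast
      qed
    qed
  qed
  have DQ: "D i \<subseteq> ?Q" for i by (auto simp: D_def split: prod.splits option.splits)
  have ne: "?I \<noteq> {}" using infP by auto
  obtain G where G: "forcing_filter ?Q ?R G" and GD: "\<And>i. i \<in> ?I \<Longrightarrow> G \<inter> D i \<noteq> {}"
  proof (rule MA_dense[OF MAQ trans_promise_order empty_promise_cond assms(1) I ne DQ dense])
    fix G assume "forcing_filter ?Q ?R G" "\<And>i. i \<in> ?I \<Longrightarrow> G \<inter> D i \<noteq> {}"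
    then show thesis by (rule that)
  qed
  have "forced_Cohen P r (promise_name P r G) p" if p: "p \<in> P" for p
    unfolding forced_Cohen_def forced_all_def forced_ex_def
  proof (intro ballI impI)
    fix X q assume X: "X \<in> {D. dense_in_Cohen D}" and q: "q \<in> P" "(p, q) \<in> r"
    obtain c s where c: "c \<in> G" "(q, s) \<in> snd c"
      using GD[of "(q, None)"] q by (auto simp: D_def)
    \<comment> \<open>All pairs \<open>(s, t)\<close> are among the requirements, so
      \<open>t\<close> may depend on \<open>X\<close>, and the dense sets \<open>X\<close>
      themselves need not be indexed.\<close>
    obtain t where t: "s @ t \<in> X" using X by (auto simp: dense_in_Cohen_def prefix_def)
    obtain d where d: "d \<in> G" "d \<in> D (q, Some (s, t))" using GD[of "(q, Some (s, t))"] q by auto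
    obtain g where g: "(c, g) \<in> ?R" "(d, g) \<in> ?R"
      using G c(1) d(1) unfolding forcing_filter_def by blast
    then have "(q, s) \<in> snd g" using c by (auto simp: promise_order_def)
    \<comment> \<open>The common extension \<open>g\<close> still carries the promise
      \<open>(q, s)\<close>, which excludes the second disjunct for \<open>d\<close>.\<close>
    then have "\<not> (\<forall>g. (d, g) \<in> ?R \<longrightarrow> (q, s) \<notin> snd g)" using g(2) by blast
    then obtain u where u: "u \<in> P" "(q, u) \<in> r" "decides P r (fst d) u" "word r (fst d) u = s @ t"
      using d(2) by (simp add: D_def) blast
    then have "forced_initial_segment P r (s @ t) (promise_name P r G) u"
      using forced_initial_segment_promise_name[OF fn G d(1)] by simp
    then show "\<exists>u\<in>P. (q, u) \<in> r \<and> (\<exists>s\<in>X. forced_initial_segment P r s (promise_name P r G) u)"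
      using u t by blast
  qed
  then show ?thesis unfolding adds_Cohen_real_def
    by (intro exI[of _ "promise_name P r G"]) (auto simp: promise_name_def)
qed

end
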